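(* Let $b>1$ be an integer and let $\alpha\neq\beta$ be two distinct digits in $\{0,\dots,b-1\}$. Let $K_1$ be the sum of the reciprocals $1/n$ over all integers $n>0$ having in base $b$ exactly one occurrence of the two-digit string $\alpha\beta$. Then $$ \begin{aligned} K_1 ={}& b^2\sum_{b\leq n<b^2}\frac1{n} + \sum_{m=1}^\infty (-1)^m v_m \Biggl(\sum_{\substack{1\leq n_1<b\\ 0\leq n_2<b\\(n_1,n_2)\neq(\alpha,\beta)}} \frac1{\overline{n_1n_2}^{\,m+1}} - \sum_{1\leq n_1 <b}\frac1{\overline{n_1\alpha\beta}^{\,m+1}} \Biggr)\\ &+ \sum_{m=1}^\infty (-1)^m u_m \Biggl(\frac{\delta_{\alpha\neq0}}{\overline{\alpha\beta}^{\,m+1}}+ \sum_{1\leq n_1 <b}\frac1{\overline{n_1\alpha\beta}^{\,m+1}} \Biggr), \end{aligned} $$ where the sequences $(u_m)_{m\ge0}$ and $(v_m)_{m\ge0}$ obey $u_0=b^2$, $v_0=b^2$ and, for all $m\geq1$, with $\gamma_j=\sum_{0\le d<b} d^j$, $$ (b^{m+1} - b + b^{-m-1})\, u_m = \sum_{j=1}^{m}\binom{m}{j} \Bigl(\gamma_j - b^{-m-1}(\alpha b + \beta)^j\Bigr) u_{m-j}, $$ $$ (b^{m+1} - b + b^{-m-1})\, v_m = \sum_{j=1}^m\binom{m}{j} \Bigl(\bigl(\gamma_j- b^{-m-1}(\alpha b + \beta)^j\bigr)v_{m-j} + b^{-m-1}(\alpha b + \beta)^j u_{m-j}\Bigr)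 +b^{-m-1}u_m . $$
   Context: The base-$b$ representation of a positive integer is its minimal one (no leading zeroes). An occurrence of $\alpha\beta$ means that the digits $\alpha,\beta$ appear at two consecutive positions, in this order (most significant first). $\overline{n_1n_2}$ denotes $n_1b+n_2$ and $\overline{n_1n_2n_3}$ denotes $n_1b^2+n_2b+n_3$. $\delta_{\alpha\neq0}$ is $1$ if $\alpha\ne0$ and $0$ if $\alpha=0$. *)

theory Defs
  imports "HOL-Analysis.Analysis"
begin

text \<open>
  The digits of \<open>n\<close> in base \<open>b\<close>, most significant first and without leading zeroes.
  The case \<open>b < 2\<close> is a dummy that only ensures termination.
\<close>

function base_digits :: "nat \<Rightarrow> nat \<Rightarrow> nat list" where
  "base_digits b n =
     (if b < 2 \<or> n = 0 then [] else base_digits b (n div b) @ [n mod b])"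
  by pat_completeness auto
termination
  by (relation "Wellfounded.measure snd") (auto intro: div_less_dividend)

declare base_digits.simps [simp del]

lemma base_digits_value:
  assumes "b > 1"
  shows "horner_sum (\<lambda>d. d) b (rev (base_digits b n)) = n"
  using assms
proof (induction b n rule: base_digits.induct)
  case (1 b n)
  then show ?case
    by (subst base_digits.simps) auto
qed

lemma base_digits_less:
  assumes "b > 1"
  shows "set (base_digits b n) \<subseteq> {..<b}"
  using assms
proof (induction b n rule: base_digits.induct)
  case (1 b n)
  then show ?case
    by (subst base_digits.simps) auto
qed

lemma base_digits_no_leading_zero:
  assumes "b > 1" "n > 0"
  shows "base_digits b n \<noteq> [] \<and> hd (base_digits b n) \<noteq> 0"
  using assms
proof (induction b n rule: base_digits.induct)
  case (1 b n)
  show ?case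
  proof (cases "n div b = 0")
    case True
    with 1 have "base_digits b (n div b) = []" "n mod b = n"
      by (auto simp: base_digits.simps div_eq_0_iff)
    with 1 show ?thesis
      by (subst (1 2) base_digits.simps) auto
  next
    case False
    with 1 have "base_digits b (n div b) \<noteq> [] \<and> hd (base_digits b (n div b)) \<noteq> 0"
      by simp
    with 1 show ?thesis
      by (subst (1 2) base_digits.simps) auto
  qed
qed

definition occurrences2 :: "nat \<Rightarrow> nat \<Rightarrow> nat \<Rightarrow> nat \<Rightarrow> nat" where
  "occurrences2 b \<alpha> \<beta> n =
     card {i. Suc i < length (base_digits b n) \<and>
              base_digits b n ! i = \<alpha> \<and> base_digits b n ! Suc i = \<beta>}"

definition one_occurrence_set :: "nat \<Rightarrow> nat \<Rightarrow> nat \<Rightarrow> nat set" where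
  "one_occurrence_set b \<alpha> \<beta> = {n. n > 0 \<and> occurrences2 b \<alpha> \<beta> n = 1}"

definition digit_power_sum :: "nat \<Rightarrow> nat \<Rightarrow> real" where
  "digit_power_sum b j = (\<Sum>d<b. real d ^ j)"

text \<open>The two parenthesised expressions that are multiplied by \<open>(-1)\<^sup>m v\<^sub>m\<close> and \<open>(-1)\<^sup>m u\<^sub>m\<close>.\<close>

definition v_factor :: "nat \<Rightarrow> nat \<Rightarrow> nat \<Rightarrow> nat \<Rightarrow> real" where
  "v_factor b \<alpha> \<beta> m =
     (\<Sum>(n1, n2) \<in> {1..<b} \<times> {0..<b} - {(\<alpha>, \<beta>)}. 1 / real (n1 * b + n2) ^ (m + 1))
     - (\<Sum>n1 \<in> {1..<b}. 1 / real (n1 * b ^ 2 + \<alpha> * b + \<beta>) ^ (m + 1))"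

definition u_factor :: "nat \<Rightarrow> nat \<Rightarrow> nat \<Rightarrow> nat \<Rightarrow> real" where
  "u_factor b \<alpha> \<beta> m =
     of_bool (\<alpha> \<noteq> 0) / real (\<alpha> * b + \<beta>) ^ (m + 1)
     + (\<Sum>n1 \<in> {1..<b}. 1 / real (n1 * b ^ 2 + \<alpha> * b + \<beta>) ^ (m + 1))"

end

theory Submission
  imports Defs
begin

text \<open>
  The sequences \<^term>\<open>u\<close> and \<^term>\<open>v\<close> are the moments of two finite measures on \<open>[0, 1)\<close>.
  A word \<open>w\<close> over the digits (leading zeros allowed) is a point mass \<open>b\<^bsup>-|w|\<^esup>\<close> at the number
  \<open>x(w) = 0.w\<close>, and \<open>\<mu>\<^sub>k\<close> collects the words with exactly \<open>k\<close> occurrences of \<open>\<alpha>\<beta>\<close>. An integer whose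
  digits are a prefix of value \<open>p\<close> followed by \<open>w\<close> equals \<open>(p + x(w)) b\<^bsup>|w|\<^esup>\<close>, so summing its
  reciprocal over the words counted by \<open>\<mu>\<^sub>k\<close> gives \<open>\<integral> d\<mu>\<^sub>k(x) / (p + x)\<close>. Since \<open>p \<ge> 2 > x\<close>, the geometric
  series turns this integral into \<open>\<Sum>m. (-1)\<^sup>m \<integral>x\<^sup>m d\<mu>\<^sub>k / p\<^bsup>m+1\<^esup>\<close> (lemma \<open>tail_sum_sums\<close>).

  Prefixing a digit to a word creates an occurrence only when that digit is \<open>\<alpha>\<close> and the word starts
  with \<open>\<beta>\<close>; because \<open>\<alpha> \<noteq> \<beta>\<close>, the initial \<open>\<beta>\<close> itself takes part in no other occurrence. Hence the words
  \<open>w\<close> such that \<open>\<alpha>w\<close> has \<open>k\<close> occurrences are obtained from those with \<open>k\<close> occurrences by exchanging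
  the words \<open>\<beta>w'\<close> with \<open>w'\<close> in class \<open>k\<close> for those with \<open>w'\<close> in class \<open>k - 1\<close>
  (lemma \<open>has_sum_words_after_\<alpha>\<close>). This one exchange is used twice.

  Applied to the first digit of a word, it gives a self-similarity of \<open>\<mu>\<^sub>k\<close>
  (lemma \<open>infsum_words_first_digit\<close>). Testing it on \<open>x\<^sup>m\<close> and expanding by the binomial theorem yields
  the two recurrences, at \<open>k = 0\<close> and \<open>k = 1\<close>; testing it on \<open>1\<close>, truncated to bounded length, shows that
  the total mass is finite and equal to \<open>b\<^sup>2\<close>. The coefficient on the left of the recurrences is positive,
  so they determine \<open>u\<close> and \<open>v\<close>.

  Applied to the integers whose first two digits are \<open>n\<^sub>1\<alpha>\<close>, it produces the corrections with
  denominators \<open>n\<^sub>1\<alpha>\<beta>\<close>; the prefix \<open>\<alpha>\<beta>\<close> has already used up the single occurrence, so its tails are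
  measured by \<open>\<mu>\<^sub>0\<close> instead of \<open>\<mu>\<^sub>1\<close>. Expanding every integral and isolating the
  terms with \<open>m = 0\<close>, in which the corrections cancel, gives the formula.
\<close>

section \<open>Digits and prefixes\<close>

lemma base_digits_foldl:
  assumes "b > 1" "set ds \<subseteq> {..<b}" "ds \<noteq> []" "hd ds \<noteq> 0"
  shows "base_digits b (foldl (\<lambda>n d. n * b + d) 0 ds) = ds"
  using assms(2-)
proof (induction ds rule: rev_induct)
  case Nil
  then show ?case by simp
next
  case (snoc d ds)
  show ?case
  proof (cases "ds = []")
    case True
    with snoc assms(1) show ?thesis
      by (simp add: base_digits.simps[of b d] base_digits.simps[of b 0])
  next
    case False
    define N where "N = foldl (\<lambda>n d. n * b + d) 0 ds"
    have IH: "base_digits b N = ds" using snoc False by (simp add: N_def)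
    hence "N \<noteq> 0" using False base_digits.simps[of b 0] by metis
    moreover have "(N * b + d) div b = N" "(N * b + d) mod b = d" "d < b"
      using snoc.prems(1) assms(1) by auto
    ultimately have "base_digits b (N * b + d) = ds @ [d]"
      using IH assms(1) by (subst base_digits.simps) auto
    thus ?thesis by (simp add: N_def)
  qed
qed

lemma foldl_base_digits:
  assumes "b > 1"
  shows "foldl (\<lambda>n d. n * b + d) 0 (base_digits b n) = n"
  using assms
proof (induction b n rule: base_digits.induct)
  case (1 b n)
  then show ?case
    by (subst base_digits.simps) auto
qed

lemma has_sum_finite_sum:
  fixes f :: "'i \<Rightarrow> 'a \<Rightarrow> real"
  assumes "\<And>i. i \<in> I \<Longrightarrow> (f i has_sum s i) A"
  shows "((\<lambda>x. \<Sum>i\<in>I. f i x) has_sum (\<Sum>i\<in>I. s i)) A"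
  using assms by (induction I rule: infinite_finite_induct) (auto intro: has_sum_add)

section \<open>Words classified by the number of occurrences\<close>

locale digit_pair =
  fixes b \<alpha> \<beta> :: nat
  assumes base: "b > 1" and \<alpha>_less: "\<alpha> < b" and \<beta>_less: "\<beta> < b" and distinct: "\<alpha> \<noteq> \<beta>"
begin

primrec pairs :: "nat list \<Rightarrow> nat" where
  "pairs [] = 0"
| "pairs (d # w) = of_bool (d = \<alpha> \<and> w \<noteq> [] \<and> hd w = \<beta>) + pairs w"

lemma pairs_eq_card:
  "pairs w = card {i. Suc i < length w \<and> w ! i = \<alpha> \<and> w ! Suc i = \<beta>}"
proof (induction w)
  case Nil
  then show ?case by simp
next
  case (Cons d w)
  let ?P = "\<lambda>w i. Suc i < length w \<and> w ! i = \<alpha> \<and> w ! Suc i = \<beta>"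
  let ?first = "d = \<alpha> \<and> w \<noteq> [] \<and> hd w = \<beta>"
  have first: "?P (d # w) 0 \<longleftrightarrow> ?first"
    by (cases w) auto
  have split: "{i. ?P (d # w) i} = (if ?first then {0} else {}) \<union> Suc ` {i. ?P w i}"
  proof (intro set_eqI)
    fix i
    show "i \<in> {i. ?P (d # w) i} \<longleftrightarrow> i \<in> (if ?first then {0} else {}) \<union> Suc ` {i. ?P w i}"
      using first by (cases i) (auto simp: image_iff)
  qed
  have "finite {i. ?P w i}"
    by (rule finite_subset[of _ "{..<length w}"]) auto
  then have "card {i. ?P (d # w) i} = of_bool ?first + card {i. ?P w i}"
    unfolding split by (subst card_Un_disjoint) (auto simp: card_image)
  then show ?case
    using Cons by simp
qed

text \<open>
  The number of occurrences is an integer so that the class \<open>k - 1\<close> of \<open>k = 0\<close> is empty, which makes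
  the recursions below uniform in \<open>k\<close>.
\<close>

definition words_with :: "int \<Rightarrow> nat list set" where
  "words_with k = {w. set w \<subseteq> {..<b} \<and> int (pairs w) = k}"

definition words_after_\<alpha> :: "int \<Rightarrow> nat list set" where
  "words_after_\<alpha> k = {w. set w \<subseteq> {..<b} \<and> int (pairs (\<alpha> # w)) = k}"

lemma Nil_in_words_with [simp]: "[] \<in> words_with k \<longleftrightarrow> k = 0"
  by (auto simp: words_with_def)

lemma Cons_\<beta>_in_words_with: "\<beta> # w \<in> words_with k \<longleftrightarrow> w \<in> words_with k"
  using distinct \<beta>_less by (auto simp: words_with_def)

text \<open>
  A word that does not start with \<open>\<beta>\<close> has as many occurrences as the same word preceded by \<open>\<alpha>\<close>; a word
  that starts with \<open>\<beta>\<close> gains one. Writing the exchange with disjoint unions on both sides lets it be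
  read off as an identity between sums.
\<close>

lemma words_after_\<alpha>_Un:
  "words_after_\<alpha> k \<union> Cons \<beta> ` words_with k = words_with k \<union> Cons \<beta> ` words_with (k - 1)"
  "words_after_\<alpha> k \<inter> Cons \<beta> ` words_with k = {}"
  "words_with k \<inter> Cons \<beta> ` words_with (k - 1) = {}"
proof -
  have split: "w \<in> words_after_\<alpha> k \<union> Cons \<beta> ` words_with k \<longleftrightarrow>
      w \<in> words_with k \<union> Cons \<beta> ` words_with (k - 1)" for w
    using distinct \<beta>_less
    by (cases w) (auto simp: words_after_\<alpha>_def words_with_def image_iff split: if_splits)
  then show "words_after_\<alpha> k \<union> Cons \<beta> ` words_with k = words_with k \<union> Cons \<beta> ` words_with (k - 1)"
    by blast
  show "words_after_\<alpha> k \<inter> Cons \<beta> ` words_with k = {}"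
    using distinct by (auto simp: words_after_\<alpha>_def words_with_def)
  have "words_with k \<inter> words_with (k - 1) = {}"
    by (simp add: words_with_def disjoint_iff)
  then show "words_with k \<inter> Cons \<beta> ` words_with (k - 1) = {}"
    using Cons_\<beta>_in_words_with by blast
qed

lemma summable_on_Cons:
  fixes F :: "nat list \<Rightarrow> real"
  assumes "\<And>j. F summable_on words_with j" "d < b"
  shows "(\<lambda>w. F (d # w)) summable_on words_with k"
proof -
  have "F summable_on (words_with k \<union> words_with (k + 1))"
    by (intro summable_on_union assms)
  moreover have "Cons d ` words_with k \<subseteq> words_with k \<union> words_with (k + 1)"
    using assms(2) by (auto simp: words_with_def)
  ultimately have "F summable_on (Cons d ` words_with k)"
    by (rule summable_on_subset)
  then show ?thesis
    by (subst (asm) summable_on_reindex) (auto simp: o_def)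
qed

lemma has_sum_words_after_\<alpha>:
  fixes F :: "nat list \<Rightarrow> real"
  assumes F: "\<And>j. F summable_on words_with j"
  shows "(F has_sum (infsum F (words_with k) - (\<Sum>\<^sub>\<infinity>w\<in>words_with k. F (\<beta> # w))
           + (\<Sum>\<^sub>\<infinity>w\<in>words_with (k - 1). F (\<beta> # w)))) (words_after_\<alpha> k)"
proof -
  have shift: "F summable_on Cons \<beta> ` words_with j"
      "infsum F (Cons \<beta> ` words_with j) = (\<Sum>\<^sub>\<infinity>w\<in>words_with j. F (\<beta> # w))" for j
    using summable_on_Cons[OF F \<beta>_less]
    by (simp_all add: summable_on_reindex infsum_reindex o_def)
  have "F summable_on (words_with k \<union> Cons \<beta> ` words_with (k - 1))"
    by (intro summable_on_union F shift)
  then have after: "F summable_on words_after_\<alpha> k"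
    by (rule summable_on_subset) (use words_after_\<alpha>_Un(1)[of k] in blast)
  have "infsum F (words_after_\<alpha> k) + infsum F (Cons \<beta> ` words_with k)
      = infsum F (words_with k) + infsum F (Cons \<beta> ` words_with (k - 1))"
    using words_after_\<alpha>_Un[of k] F shift(1) after by (metis infsum_Un_disjoint)
  then have "infsum F (words_after_\<alpha> k) = infsum F (words_with k)
      - (\<Sum>\<^sub>\<infinity>w\<in>words_with k. F (\<beta> # w)) + (\<Sum>\<^sub>\<infinity>w\<in>words_with (k - 1). F (\<beta> # w))"
    by (simp add: shift(2))
  then show ?thesis
    using has_sum_infsum[OF after] by simp
qed

text \<open>
  The self-similarity of the classes of words: removing the first digit of a nonempty word leaves a word
  in the same class, except after \<open>\<alpha>\<close>, where the exchange of words starting with \<open>\<beta>\<close> accounts for the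
  last two terms. The summand is arbitrary because the identity is applied to truncated weights as well
  as to moments.
\<close>

lemma infsum_words_first_digit:
  fixes F :: "nat list \<Rightarrow> real"
  assumes F: "\<And>j. F summable_on words_with j"
  shows "infsum F (words_with k) = of_bool (k = 0) * F []
    + (\<Sum>d<b. \<Sum>\<^sub>\<infinity>w\<in>words_with k. F (d # w))
    - (\<Sum>\<^sub>\<infinity>w\<in>words_with k. F (\<alpha> # \<beta> # w)) + (\<Sum>\<^sub>\<infinity>w\<in>words_with (k - 1). F (\<alpha> # \<beta> # w))"
proof -
  define tails where "tails d = {w. d # w \<in> words_with k}" for d
  define c where "c = (\<Sum>\<^sub>\<infinity>w\<in>words_with k. F (\<alpha> # \<beta> # w))
    - (\<Sum>\<^sub>\<infinity>w\<in>words_with (k - 1). F (\<alpha> # \<beta> # w))"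
  have tails: "tails d = (if d = \<alpha> then words_after_\<alpha> k else words_with k)" if "d < b" for d
    using that by (auto simp: tails_def words_after_\<alpha>_def words_with_def)
  have part: "(F has_sum ((\<Sum>\<^sub>\<infinity>w\<in>words_with k. F (d # w)) - of_bool (d = \<alpha>) * c)) (Cons d ` tails d)"
    if "d \<in> {..<b}" for d
  proof -
    have "((\<lambda>w. F (d # w)) has_sum
      ((\<Sum>\<^sub>\<infinity>w\<in>words_with k. F (d # w)) - of_bool (d = \<alpha>) * c)) (tails d)"
    proof (cases "d = \<alpha>")
      case True
      then show ?thesis
        using has_sum_words_after_\<alpha>[of "\<lambda>w. F (\<alpha> # w)" k] summable_on_Cons[OF F \<alpha>_less] that
        by (simp add: tails c_def algebra_simps)
    next
      case False
      then show ?thesis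
        using has_sum_infsum[OF summable_on_Cons[OF F, of d]] that by (simp add: tails)
    qed
    then show ?thesis
      by (subst has_sum_reindex) (auto simp: o_def)
  qed
  have "(F has_sum (\<Sum>d<b. (\<Sum>\<^sub>\<infinity>w\<in>words_with k. F (d # w)) - of_bool (d = \<alpha>) * c))
      (\<Union>d<b. Cons d ` tails d)"
    by (rule sum_has_sum[OF _ part]) auto
  moreover have "(F has_sum (of_bool (k = 0) * F [])) (if k = 0 then {[]} else {})"
    by (auto intro: has_sum_finiteI)
  ultimately have total: "(F has_sum ((\<Sum>d<b. (\<Sum>\<^sub>\<infinity>w\<in>words_with k. F (d # w)) - of_bool (d = \<alpha>) * c)
       + of_bool (k = 0) * F [])) ((\<Union>d<b. Cons d ` tails d) \<union> (if k = 0 then {[]} else {}))"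
    by (rule has_sum_Un_disjoint) auto
  have "w \<in> (\<Union>d<b. Cons d ` tails d) \<union> (if k = 0 then {[]} else {}) \<longleftrightarrow>
      w \<in> words_with k" for w
    by (cases w) (auto simp: tails_def words_with_def image_iff)
  then have cover: "(\<Union>d<b. Cons d ` tails d) \<union> (if k = 0 then {[]} else {}) = words_with k"
    by blast
  have "infsum F (words_with k)
      = (\<Sum>d<b. (\<Sum>\<^sub>\<infinity>w\<in>words_with k. F (d # w)) - of_bool (d = \<alpha>) * c) + of_bool (k = 0) * F []"
    using infsumI[OF total[unfolded cover]] .
  moreover have "(\<Sum>d<b. of_bool (d = \<alpha>) * c) = c"
  proof -
    have "(\<Sum>d<b. of_bool (d = \<alpha>) * c) = (\<Sum>d<b. if d = \<alpha> then c else 0)"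
      by (intro sum.cong) auto
    also have "\<dots> = c" using \<alpha>_less by simp
    finally show ?thesis .
  qed
  ultimately show ?thesis
    by (simp add: sum_subtractf c_def)
qed

section \<open>The number represented by a word\<close>

text \<open>The number \<open>0.w\<close> in base \<open>b\<close>.\<close>

primrec frac_value :: "nat list \<Rightarrow> real" where
  "frac_value [] = 0"
| "frac_value (d # w) = (real d + frac_value w) / real b"

lemma frac_value_bounds:
  assumes "w \<in> words_with k"
  shows "0 \<le> frac_value w" "frac_value w < 1"
proof -
  have "set w \<subseteq> {..<b} \<Longrightarrow> 0 \<le> frac_value w \<and> frac_value w < 1"
  proof (induction w)
    case (Cons d w)
    have "d < b" using Cons.prems by simp
    then have "real d + 1 \<le> real b" by simp
    moreover have "0 \<le> frac_value w" "frac_value w < 1"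
      using Cons by auto
    ultimately show ?case
      using base by simp
  qed simp
  then show "0 \<le> frac_value w" "frac_value w < 1"
    using assms by (auto simp: words_with_def)
qed

lemma frac_value_power_bounds:
  assumes "w \<in> words_with k"
  shows "0 \<le> frac_value w ^ m" "frac_value w ^ m \<le> 1"
  using frac_value_bounds[OF assms] by (auto intro: power_le_one)

lemma foldl_eq_frac_value:
  "real (foldl (\<lambda>n d. n * b + d) p w) = (real p + frac_value w) * real b ^ length w"
proof (induction w arbitrary: p)
  case (Cons d w)
  have "real p * real b + real d + x = (real p + (real d + x) / real b) * real b" for x
    using base by (simp add: field_simps)
  then show ?case
    using Cons[of "p * b + d"] by simp
qed simp

section \<open>Finiteness of the total weight\<close>

lemma summable_truncated:
  "(\<lambda>w. of_bool (length w \<le> L) / real b ^ length w) summable_on words_with k"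
proof -
  have "finite {w. set w \<subseteq> {..<b} \<and> length w \<le> L}"
    by (rule finite_lists_length_le) simp
  then have fin: "finite (words_with k \<inter> {w. length w \<le> L})"
    by (rule rev_finite_subset) (auto simp: words_with_def)
  then have "((\<lambda>w. of_bool (length w \<le> L) / real b ^ length w) has_sum
      (\<Sum>w\<in>words_with k \<inter> {w. length w \<le> L}. of_bool (length w \<le> L) / real b ^ length w)) (words_with k)"
    by (intro has_sum_finite_neutralI[OF fin]) auto
  then show ?thesis
    by (auto simp: summable_on_def)
qed

definition truncated_mass :: "int \<Rightarrow> nat \<Rightarrow> real" where
  "truncated_mass k L = (\<Sum>\<^sub>\<infinity>w\<in>words_with k. of_bool (length w \<le> L) / real b ^ length w)"

lemma truncated_mass_mono: "L \<le> L' \<Longrightarrow> truncated_mass k L \<le> truncated_mass k L'"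
  unfolding truncated_mass_def by (intro infsum_mono summable_truncated) (auto simp: divide_right_mono)

lemma truncated_mass_recurrence:
  "truncated_mass k (L + 2) = of_bool (k = 0) + truncated_mass k (L + 1)
     - truncated_mass k L / real b ^ 2 + truncated_mass (k - 1) L / real b ^ 2"
proof -
  define F where "F = (\<lambda>w::nat list. of_bool (length w \<le> L + 2) / real b ^ length w)"
  have one: "(\<Sum>\<^sub>\<infinity>w\<in>words_with k. F (d # w)) = truncated_mass k (L + 1) / real b" for d
  proof -
    have "F (d # w) = 1 / real b * (of_bool (length w \<le> L + 1) / real b ^ length w)" for w
      by (simp add: F_def)
    then show ?thesis
      by (simp only: infsum_cmult_right' truncated_mass_def) simp
  qed
  have two: "(\<Sum>\<^sub>\<infinity>w\<in>words_with j. F (d # e # w)) = truncated_mass j L / real b ^ 2" for j d e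
  proof -
    have "F (d # e # w) = 1 / real b ^ 2 * (of_bool (length w \<le> L) / real b ^ length w)" for w
      by (simp add: F_def power2_eq_square)
    then show ?thesis
      by (simp only: infsum_cmult_right' truncated_mass_def) simp
  qed
  have "F summable_on words_with j" for j
    unfolding F_def by (rule summable_truncated)
  from infsum_words_first_digit[OF this, of k] show ?thesis
    unfolding one two using base by (simp add: F_def truncated_mass_def)
qed

text \<open>
  In the recurrence the mass up to length \<open>L + 1\<close> is at most the mass up to length \<open>L + 2\<close>, so what
  remains bounds the mass up to length \<open>L\<close> by \<open>b\<^sup>2\<close> (only for \<open>k = 0\<close>) plus the mass of the preceding
  class. Hence the bound does not depend on \<open>L\<close>, and the total weight of every class is finite.
\<close>

lemma truncated_mass_le: "truncated_mass k L \<le> real b ^ 2"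
proof -
  have step: "truncated_mass k L \<le> of_bool (k = 0) * real b ^ 2 + truncated_mass (k - 1) L" for k
  proof -
    have "truncated_mass k L / real b ^ 2 \<le> of_bool (k = 0) + truncated_mass (k - 1) L / real b ^ 2"
      using truncated_mass_recurrence[of k L] truncated_mass_mono[of "L + 1" "L + 2" k] by simp
    then show ?thesis using base by (simp add: field_simps)
  qed
  have neg: "truncated_mass k L = 0" if "k < 0" for k
  proof -
    have "words_with k = {}" using that by (auto simp: words_with_def)
    then show ?thesis by (simp add: truncated_mass_def)
  qed
  have "truncated_mass (int n) L \<le> real b ^ 2" for n
  proof (induction n)
    case 0
    then show ?case using step[of 0] neg[of "-1"] by simp
  next
    case (Suc n)
    then show ?case using step[of "int (Suc n)"] by simp
  qed
  then show ?thesis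
    using neg[of k] by (cases "k < 0") (auto simp: not_less dest: zero_le_imp_eq_int)
qed

lemma summable_weights: "(\<lambda>w. 1 / real b ^ length w) summable_on words_with k"
proof (rule nonneg_bdd_above_summable_on)
  show "bdd_above (sum (\<lambda>w. 1 / real b ^ length w) ` {S. S \<subseteq> words_with k \<and> finite S})"
  proof (rule bdd_aboveI2)
    fix S assume S: "S \<in> {S. S \<subseteq> words_with k \<and> finite S}"
    obtain L where L: "\<And>w. w \<in> S \<Longrightarrow> length w \<le> L"
      using S finite_nat_set_iff_bounded_le[of "length ` S"] by auto
    have "(\<Sum>w\<in>S. 1 / real b ^ length w) = (\<Sum>w\<in>S. of_bool (length w \<le> L) / real b ^ length w)"
      using L by (intro sum.cong) auto
    also have "\<dots> \<le> truncated_mass k L"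
      unfolding truncated_mass_def
      using S by (intro finite_sum_le_infsum summable_truncated) auto
    also have "\<dots> \<le> real b ^ 2" by (rule truncated_mass_le)
    finally show "(\<Sum>w\<in>S. 1 / real b ^ length w) \<le> real b ^ 2" .
  qed
qed auto

lemma summable_bounded_weights:
  assumes "\<And>w. w \<in> words_with k \<Longrightarrow> 0 \<le> f w" "\<And>w. w \<in> words_with k \<Longrightarrow> f w \<le> 1"
  shows "(\<lambda>w. f w / real b ^ length w) summable_on words_with k"
  by (rule summable_on_comparison_test[OF summable_weights]) (use assms in \<open>auto intro!: divide_right_mono\<close>)

section \<open>Moments and their recurrences\<close>

definition moment :: "int \<Rightarrow> nat \<Rightarrow> real" where
  "moment k m = (\<Sum>\<^sub>\<infinity>w\<in>words_with k. frac_value w ^ m / real b ^ length w)"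

lemma summable_moment: "(\<lambda>w. frac_value w ^ m / real b ^ length w) summable_on words_with k"
  by (intro summable_bounded_weights frac_value_power_bounds)

lemma has_sum_moment: "((\<lambda>w. frac_value w ^ m / real b ^ length w) has_sum moment k m) (words_with k)"
  unfolding moment_def by (rule has_sum_infsum[OF summable_moment])

lemma moment_neg: "k < 0 \<Longrightarrow> moment k m = 0"
  by (auto simp: moment_def words_with_def)

lemma translated_moment:
  "(\<Sum>\<^sub>\<infinity>w\<in>words_with k. (c + frac_value w) ^ m / real b ^ length w)
     = (\<Sum>j\<le>m. real (m choose j) * c ^ j * moment k (m - j))"
proof (rule infsumI)
  have "((\<lambda>w. \<Sum>j\<le>m. real (m choose j) * c ^ j * (frac_value w ^ (m - j) / real b ^ length w)) has_sum
      (\<Sum>j\<le>m. real (m choose j) * c ^ j * moment k (m - j))) (words_with k)"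
    by (intro has_sum_finite_sum has_sum_cmult_right has_sum_moment)
  then show "((\<lambda>w. (c + frac_value w) ^ m / real b ^ length w) has_sum
      (\<Sum>j\<le>m. real (m choose j) * c ^ j * moment k (m - j))) (words_with k)"
    by (simp add: binomial_ring sum_divide_distrib)
qed

text \<open>
  The first-digit identity for \<open>x\<^sup>m\<close>, multiplied by \<open>b\<^bsup>m+1\<^esup>\<close>: a first digit \<open>d\<close> contributes
  \<open>((d + x) / b)\<^sup>m / b\<close>, and a prefix \<open>\<alpha>\<beta>\<close> contributes \<open>((\<alpha>b + \<beta> + x) / b\<^sup>2)\<^sup>m / b\<^sup>2\<close>. The terms \<open>j = 0\<close> of the
  binomial expansions, in which \<open>moment k m\<close> itself occurs, make up the coefficient on the left.
  For \<open>m = 0\<close> the empty word contributes as well; that case is treated separately.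
\<close>

lemma moment_recurrence:
  assumes "m \<ge> 1"
  shows "(real b ^ (m + 1) - real b + real b powi (- int m - 1)) * moment k m =
    (\<Sum>j=1..m. real (m choose j) *
      ((digit_power_sum b j - real b powi (- int m - 1) * real (\<alpha> * b + \<beta>) ^ j) * moment k (m - j)
       + real b powi (- int m - 1) * real (\<alpha> * b + \<beta>) ^ j * moment (k - 1) (m - j)))
    + real b powi (- int m - 1) * moment (k - 1) m"
proof -
  define F where "F = (\<lambda>w. frac_value w ^ m / real b ^ length w)"
  \<comment> \<open>\<open>q\<close> is the factor gained for each digit prefixed, from the weight and the scaling of \<open>x\<^sup>m\<close> together.\<close>
  define q where "q = real b powi (- int m - 1)"
  define B where "B = real b ^ (m + 1)"
  define c where "c = real (\<alpha> * b + \<beta>)"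
  define S where "S = (\<lambda>k x. \<Sum>j=1..m. real (m choose j) * x ^ j * moment k (m - j))"
  have B: "B > 0" using base by (simp add: B_def)
  have "- int m - 1 = - int (m + 1)" by simp
  then have q: "q = 1 / B"
    unfolding q_def B_def by (simp only: power_int_minus power_int_of_nat inverse_eq_divide)
  have translated: "(\<Sum>\<^sub>\<infinity>w\<in>words_with j. (x + frac_value w) ^ m / real b ^ length w)
      = moment j m + S j x" for j x
  proof -
    have "{..m} = insert 0 {1..m}" by auto
    then show ?thesis
      unfolding translated_moment by (simp add: S_def)
  qed
  have one: "(\<Sum>\<^sub>\<infinity>w\<in>words_with k. F (d # w)) = q * (moment k m + S k (real d))" for d
  proof -
    have "F (d # w) = q * ((real d + frac_value w) ^ m / real b ^ length w)" for w
      by (simp add: F_def q B_def power_divide)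
    then show ?thesis
      by (simp only: infsum_cmult_right' translated)
  qed
  have two: "(\<Sum>\<^sub>\<infinity>w\<in>words_with j. F (\<alpha> # \<beta> # w)) = q\<^sup>2 * (moment j m + S j c)" for j
  proof -
    have "F (\<alpha> # \<beta> # w) = q\<^sup>2 * ((c + frac_value w) ^ m / real b ^ length w)" for w
    proof -
      have "frac_value (\<alpha> # \<beta> # w) = (c + frac_value w) / real b ^ 2"
        using base by (simp add: c_def field_simps power2_eq_square)
      then show ?thesis
        by (simp add: F_def q B_def power_divide power2_eq_square power_mult_distrib)
    qed
    then show ?thesis
      by (simp only: infsum_cmult_right' translated)
  qed
  have "F summable_on words_with j" for j
    unfolding F_def by (rule summable_moment)
  from infsum_words_first_digit[OF this, of k]
  have "moment k m = q * (\<Sum>d<b. moment k m + S k (real d))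
      - q\<^sup>2 * (moment k m + S k c) + q\<^sup>2 * (moment (k - 1) m + S (k - 1) c)"
    unfolding one two using assms by (simp add: F_def moment_def sum_distrib_left power_0_left)
  then have "B * moment k m = B * (q * (\<Sum>d<b. moment k m + S k (real d))
      - q\<^sup>2 * (moment k m + S k c) + q\<^sup>2 * (moment (k - 1) m + S (k - 1) c))"
    by simp
  also have "\<dots> = (\<Sum>d<b. moment k m + S k (real d))
      - q * (moment k m + S k c) + q * (moment (k - 1) m + S (k - 1) c)"
    using B by (simp add: q field_simps power2_eq_square)
  also have "(\<Sum>d<b. moment k m + S k (real d))
      = real b * moment k m + (\<Sum>j=1..m. real (m choose j) * digit_power_sum b j * moment k (m - j))"
    unfolding S_def sum.distrib
    by (subst sum.swap) (simp add: digit_power_sum_def sum_distrib_left sum_distrib_right)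
  finally have "(B - real b + q) * moment k m =
      (\<Sum>j=1..m. real (m choose j) * digit_power_sum b j * moment k (m - j))
      - q * S k c + q * S (k - 1) c + q * moment (k - 1) m"
    by (simp add: algebra_simps)
  also have "\<dots> = (\<Sum>j=1..m. real (m choose j) *
      ((digit_power_sum b j - q * c ^ j) * moment k (m - j) + q * c ^ j * moment (k - 1) (m - j)))
      + q * moment (k - 1) m"
    unfolding S_def by (simp add: sum_distrib_left flip: sum.distrib sum_subtractf) (simp add: algebra_simps)
  finally show ?thesis
    by (simp only: B_def q_def c_def)
qed

text \<open>
  The mass \<open>moment k 0\<close> cancels against the \<open>b\<close> first digits, which carry weight \<open>1 / b\<close> each; what is
  left is the empty word (only for \<open>k = 0\<close>) and the terms for the prefix \<open>\<alpha>\<beta>\<close>.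
\<close>

lemma moment_zero:
  "moment k 0 = of_bool (k = 0) * real b ^ 2 + moment (k - 1) 0"
proof -
  define F where "F = (\<lambda>w::nat list. 1 / real b ^ length w)"
  have mass: "(\<Sum>\<^sub>\<infinity>w\<in>words_with j. 1 / real b ^ length w) = moment j 0" for j
    by (simp add: moment_def)
  have one: "(\<Sum>\<^sub>\<infinity>w\<in>words_with k. F (d # w)) = moment k 0 / real b" for d
  proof -
    have "F (d # w) = 1 / real b * (1 / real b ^ length w)" for w
      by (simp add: F_def)
    then show ?thesis
      by (simp only: infsum_cmult_right' mass) simp
  qed
  have two: "(\<Sum>\<^sub>\<infinity>w\<in>words_with j. F (d # e # w)) = moment j 0 / real b ^ 2" for j d e
  proof -
    have "F (d # e # w) = 1 / real b ^ 2 * (1 / real b ^ length w)" for w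
      by (simp add: F_def power2_eq_square)
    then show ?thesis
      by (simp only: infsum_cmult_right' mass) simp
  qed
  have "F summable_on words_with j" for j
    unfolding F_def by (rule summable_weights)
  from infsum_words_first_digit[OF this, of k]
  have "moment k 0 = of_bool (k = 0) + moment k 0 - moment k 0 / real b ^ 2
      + moment (k - 1) 0 / real b ^ 2"
    unfolding one two using base by (simp add: F_def mass)
  then show ?thesis
    using base by (simp add: field_simps)
qed

lemma moment_bounds: "0 \<le> moment k m" "moment k m \<le> moment k 0"
proof -
  show "0 \<le> moment k m"
    unfolding moment_def by (rule infsum_nonneg) (simp add: frac_value_bounds)
  show "moment k m \<le> moment k 0"
    unfolding moment_def
    by (intro infsum_mono summable_moment)
       (use frac_value_power_bounds(2) in \<open>auto intro!: divide_right_mono\<close>)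
qed

lemma recurrence_coefficient_pos:
  assumes "m \<ge> 1"
  shows "real b ^ (m + 1) - real b + real b powi (- int m - 1) > 0"
proof -
  have "real b \<le> real b ^ (m + 1)"
    using base by (intro self_le_power) auto
  moreover have "real b powi (- int m - 1) > 0"
    using base by simp
  ultimately show ?thesis by linarith
qed

lemma moment_unique:
  fixes s t :: "nat \<Rightarrow> real"
  assumes "s 0 = moment k 0" and t: "t = moment (k - 1)"
    and rec: "\<And>m. m \<ge> 1 \<Longrightarrow>
      (real b ^ (m + 1) - real b + real b powi (- int m - 1)) * s m =
      (\<Sum>j=1..m. real (m choose j) *
        ((digit_power_sum b j - real b powi (- int m - 1) * real (\<alpha> * b + \<beta>) ^ j) * s (m - j)
         + real b powi (- int m - 1) * real (\<alpha> * b + \<beta>) ^ j * t (m - j)))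
      + real b powi (- int m - 1) * t m"
  shows "s = moment k"
proof
  fix m
  show "s m = moment k m"
  proof (induction m rule: less_induct)
    case (less m)
    show ?case
    proof (cases "m = 0")
      case True
      then show ?thesis using assms(1) by simp
    next
      case False
      then have "m \<ge> 1" by simp
      have "s (m - j) = moment k (m - j)" if "j \<in> {1..m}" for j
        using less[of "m - j"] that by auto
      then have "(real b ^ (m + 1) - real b + real b powi (- int m - 1)) * s m
        = (real b ^ (m + 1) - real b + real b powi (- int m - 1)) * moment k m"
        unfolding rec[OF \<open>m \<ge> 1\<close>] moment_recurrence[OF \<open>m \<ge> 1\<close>] t
        by (intro arg_cong2[where f = "(+)"] sum.cong) auto
      then show ?thesis
        using recurrence_coefficient_pos[OF \<open>m \<ge> 1\<close>] by simp
    qed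
  qed
qed

section \<open>Sums over all continuations of a prefix\<close>

text \<open>
  The sum of the reciprocals of the numbers obtained by appending to a prefix of value \<open>p\<close> all words with
  \<open>k\<close> occurrences; occurrences that involve the prefix are not counted.
\<close>

definition tail_sum :: "int \<Rightarrow> nat \<Rightarrow> real" where
  "tail_sum k p = (\<Sum>\<^sub>\<infinity>w\<in>words_with k. 1 / (real p + frac_value w) / real b ^ length w)"

lemma summable_remainder:
  assumes "p \<ge> 1"
  shows "(\<lambda>w. frac_value w ^ N / (real p + frac_value w) / real b ^ length w) summable_on words_with k"
proof (rule summable_bounded_weights)
  fix w assume "w \<in> words_with k"
  note x = frac_value_bounds[OF this]
  show "0 \<le> frac_value w ^ N / (real p + frac_value w)" using x by simp
  have "frac_value w ^ N \<le> 1" by (rule frac_value_power_bounds) fact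
  then show "frac_value w ^ N / (real p + frac_value w) \<le> 1"
    using x assms by (simp add: divide_le_eq_1)
qed

text \<open>
  The geometric series \<open>1 / (p + x) = \<Sum>m. (-1)\<^sup>m x\<^sup>m / p\<^bsup>m+1\<^esup>\<close> integrated term by term. The exact remainder
  after \<open>N\<close> terms is \<open>(-1/p)\<^sup>N\<close> times a quantity bounded by the total mass, so it
  vanishes in the limit, and no interchange of infinite sums occurs.
\<close>

lemma tail_sum_sums:
  assumes "p \<ge> 2"
  shows "(\<lambda>m. (-1) ^ m * moment k m * (1 / real p ^ (m + 1))) sums tail_sum k p"
proof -
  define R where "R N = (\<Sum>\<^sub>\<infinity>w\<in>words_with k.
    frac_value w ^ N / (real p + frac_value w) / real b ^ length w)" for N
  have summable: "(\<lambda>w. frac_value w ^ N / (real p + frac_value w) / real b ^ length w)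
      summable_on words_with k" for N
    using assms by (intro summable_remainder) simp
  have step: "R N = (moment k N - R (Suc N)) / real p" for N
  proof -
    have "real p * R N + R (Suc N) = (\<Sum>\<^sub>\<infinity>w\<in>words_with k.
        real p * (frac_value w ^ N / (real p + frac_value w) / real b ^ length w)
        + frac_value w ^ Suc N / (real p + frac_value w) / real b ^ length w)"
      unfolding R_def
      by (simp only: infsum_add[OF summable_on_cmult_right[OF summable] summable] infsum_cmult_right')
    also have "\<dots> = moment k N"
      unfolding moment_def
    proof (rule infsum_cong)
      fix w assume "w \<in> words_with k"
      then have "real p + frac_value w > 0"
        using frac_value_bounds[of w k] assms by simp
      then have "real p * (frac_value w ^ N / (real p + frac_value w))
          + frac_value w ^ Suc N / (real p + frac_value w) = frac_value w ^ N"
        by (simp add: divide_simps) (simp add: algebra_simps)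
      then show "real p * (frac_value w ^ N / (real p + frac_value w) / real b ^ length w)
          + frac_value w ^ Suc N / (real p + frac_value w) / real b ^ length w
          = frac_value w ^ N / real b ^ length w"
        by (metis add_divide_distrib times_divide_eq_right)
    qed
    finally show ?thesis using assms by (simp add: field_simps)
  qed
  have R0: "R 0 = tail_sum k p"
    by (simp add: R_def tail_sum_def)
  have partial: "(\<Sum>m<N. (-1) ^ m * moment k m * (1 / real p ^ (m + 1)))
      = tail_sum k p - (-1 / real p) ^ N * R N" for N
  proof (induction N)
    case (Suc N)
    have "(-1 / real p) ^ N * R N
        = (-1) ^ N * moment k N * (1 / real p ^ (N + 1)) + (-1 / real p) ^ Suc N * R (Suc N)"
      unfolding power_divide using assms by (subst step) (simp add: field_simps)
    then show ?case
      using Suc by simp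
  qed (simp add: R0)
  have R_bounds: "0 \<le> R N" "R N \<le> moment k 0" for N
  proof -
    show "0 \<le> R N"
      unfolding R_def by (rule infsum_nonneg) (simp add: frac_value_bounds)
    have "0 \<le> R (Suc N)"
      unfolding R_def by (rule infsum_nonneg) (simp add: frac_value_bounds)
    moreover have "real p * R N + R (Suc N) = moment k N"
      using step[of N] assms by (simp add: field_simps)
    ultimately have "real p * R N \<le> moment k N" by linarith
    moreover have "1 * R N \<le> real p * R N"
      using assms \<open>0 \<le> R N\<close> by (intro mult_right_mono) auto
    ultimately show "R N \<le> moment k 0"
      using moment_bounds(2)[of k N] by simp
  qed
  have "(\<lambda>N. (-1 / real p) ^ N * R N) \<longlonglongrightarrow> 0"
  proof (rule Lim_null_comparison)
    show "(\<lambda>N. (1 / real p) ^ N * moment k 0) \<longlonglongrightarrow> 0"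
      using assms by (intro tendsto_mult_left_zero LIMSEQ_power_zero) simp
    show "eventually (\<lambda>N. norm ((-1 / real p) ^ N * R N) \<le> (1 / real p) ^ N * moment k 0) sequentially"
      using R_bounds by (auto simp: abs_mult power_abs intro!: always_eventually mult_left_mono)
  qed
  then have "(\<lambda>N. tail_sum k p - (-1 / real p) ^ N * R N) \<longlonglongrightarrow> tail_sum k p - 0"
    by (intro tendsto_intros)
  then show ?thesis
    unfolding sums_def partial by simp
qed

section \<open>Integers classified by their first two digits\<close>

definition one_occurrence_tails :: "nat \<Rightarrow> nat \<Rightarrow> nat list set" where
  "one_occurrence_tails n1 n2 = {w. set w \<subseteq> {..<b} \<and> pairs (n1 # n2 # w) = 1}"

lemma base_digits_foldl_prefix:
  assumes "n1 \<in> {1..<b}" "n2 < b" "set w \<subseteq> {..<b}"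
  shows "base_digits b (foldl (\<lambda>n d. n * b + d) (n1 * b + n2) w) = n1 # n2 # w"
  using base_digits_foldl[OF base, of "n1 # n2 # w"] assms by simp

lemma one_occurrence_set_eq_Union:
  "one_occurrence_set b \<alpha> \<beta> = (\<Union>(n1, n2)\<in>{1..<b} \<times> {0..<b}.
     foldl (\<lambda>n d. n * b + d) (n1 * b + n2) ` one_occurrence_tails n1 n2)"
proof (intro equalityI subsetI)
  fix n assume "n \<in> one_occurrence_set b \<alpha> \<beta>"
  then have n: "n > 0" "pairs (base_digits b n) = 1"
    by (auto simp: one_occurrence_set_def occurrences2_def pairs_eq_card)
  then obtain n1 n2 w where w: "base_digits b n = n1 # n2 # w"
    by (cases "base_digits b n" rule: remdups_adj.cases) auto
  have "n1 \<in> {1..<b}" "n2 \<in> {0..<b}" "w \<in> one_occurrence_tails n1 n2"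
    using base_digits_less[OF base, of n] base_digits_no_leading_zero[OF base n(1)] n(2)
    by (auto simp: one_occurrence_tails_def w)
  moreover have "n = foldl (\<lambda>n d. n * b + d) (n1 * b + n2) w"
    using foldl_base_digits[OF base, of n] by (simp add: w)
  ultimately show "n \<in> (\<Union>(n1, n2)\<in>{1..<b} \<times> {0..<b}.
      foldl (\<lambda>n d. n * b + d) (n1 * b + n2) ` one_occurrence_tails n1 n2)"
    by (intro UN_I[of "(n1, n2)"]) auto
next
  fix n assume "n \<in> (\<Union>(n1, n2)\<in>{1..<b} \<times> {0..<b}.
      foldl (\<lambda>n d. n * b + d) (n1 * b + n2) ` one_occurrence_tails n1 n2)"
  then obtain n1 n2 w where w: "n1 \<in> {1..<b}" "n2 < b" "w \<in> one_occurrence_tails n1 n2"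
      "n = foldl (\<lambda>n d. n * b + d) (n1 * b + n2) w"
    by auto
  then have digits: "base_digits b n = n1 # n2 # w"
    using base_digits_foldl_prefix by (simp add: one_occurrence_tails_def)
  then have "n > 0"
    by (cases "n = 0") (auto simp: base_digits.simps[of b 0])
  with digits w(3) show "n \<in> one_occurrence_set b \<alpha> \<beta>"
    by (simp only: one_occurrence_set_def occurrences2_def one_occurrence_tails_def
        pairs_eq_card[symmetric] mem_Collect_eq)
qed

lemma two_digit_ge_2: "n1 \<in> {1..<b} \<Longrightarrow> n1 * b + n2 \<ge> 2"
  using base mult_le_mono[of 1 n1 2 b] by simp

lemma three_digit_ge_2:
  assumes "n1 \<in> {1..<b}"
  shows "n1 * b ^ 2 + \<alpha> * b + \<beta> \<ge> 2"
proof -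
  have "n1 * b \<le> n1 * b ^ 2"
    using base by (intro mult_le_mono2 self_le_power) auto
  then show ?thesis
    using two_digit_ge_2[OF assms, of 0] by linarith
qed

text \<open>
  The excess, for a prefix \<open>n1 \<alpha>\<close>, of the continuations with one occurrence over those for which the
  whole number has one occurrence: continuations \<open>\<beta>w\<close> must have \<open>w\<close> free of \<open>\<alpha>\<beta>\<close>, not with one occurrence.
\<close>

definition correction :: "nat \<Rightarrow> real" where
  "correction n1 = tail_sum 1 (n1 * b ^ 2 + \<alpha> * b + \<beta>) - tail_sum 0 (n1 * b ^ 2 + \<alpha> * b + \<beta>)"

lemma has_sum_one_occurrence_prefix:
  assumes "n1 \<in> {1..<b}" "n2 < b"
  shows "((\<lambda>n. 1 / real n) has_sum
      (if (n1, n2) = (\<alpha>, \<beta>) then tail_sum 0 (\<alpha> * b + \<beta>) else tail_sum 1 (n1 * b + n2))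
        - of_bool (n2 = \<alpha>) * correction n1)
    (foldl (\<lambda>n d. n * b + d) (n1 * b + n2) ` one_occurrence_tails n1 n2)" (is "(_ has_sum ?s) _")
proof -
  define p where "p = n1 * b + n2"
  \<comment> \<open>\<open>F w\<close> is the reciprocal of the number whose digits are \<open>n1\<close>, \<open>n2\<close>, \<open>w\<close>.\<close>
  define F where "F = (\<lambda>w. 1 / (real p + frac_value w) / real b ^ length w)"
  have p: "p \<ge> 1" using two_digit_ge_2[OF assms(1), of n2] by (simp add: p_def)
  have F: "F summable_on words_with k" for k
    unfolding F_def using summable_remainder[OF p, of 0 k] by simp
  have sum_F: "infsum F (words_with k) = tail_sum k p" for k
    by (simp add: F_def tail_sum_def)
  have "(F has_sum ?s) (one_occurrence_tails n1 n2)"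
  proof -
    consider "n1 = \<alpha>" "n2 = \<beta>" | "n2 = \<alpha>" | "(n1, n2) \<noteq> (\<alpha>, \<beta>)" "n2 \<noteq> \<alpha>" by auto
    then show ?thesis
    proof cases
      case 1
      then have "one_occurrence_tails n1 n2 = words_with 0"
        using distinct by (auto simp: one_occurrence_tails_def words_with_def)
      then show ?thesis
        using 1 distinct has_sum_infsum[OF F, of 0] by (simp add: sum_F p_def)
    next
      case 2
      then have "one_occurrence_tails n1 n2 = words_after_\<alpha> 1"
        using distinct by (auto simp: one_occurrence_tails_def words_after_\<alpha>_def)
      moreover have "F (\<beta> # w) = 1 / (real (n1 * b ^ 2 + \<alpha> * b + \<beta>) + frac_value w) / real b ^ length w" for w
      proof -
        have "real (n1 * b ^ 2 + \<alpha> * b + \<beta>) + frac_value w = real b * (real p + frac_value (\<beta> # w))"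
          using base 2 by (simp add: p_def field_simps power2_eq_square)
        then show ?thesis by (simp add: F_def)
      qed
      then have "(\<Sum>\<^sub>\<infinity>w\<in>words_with k. F (\<beta> # w)) = tail_sum k (n1 * b ^ 2 + \<alpha> * b + \<beta>)" for k
        by (simp only: tail_sum_def)
      ultimately show ?thesis
        using has_sum_words_after_\<alpha>[OF F, of 1] 2 distinct
        by (simp add: sum_F correction_def p_def algebra_simps)
    next
      case 3
      then have "one_occurrence_tails n1 n2 = words_with 1"
        by (auto simp: one_occurrence_tails_def words_with_def)
      then show ?thesis
        using 3 has_sum_infsum[OF F, of 1] by (auto simp: sum_F p_def)
    qed
  qed
  moreover have "1 / real (foldl (\<lambda>n d. n * b + d) p w) = F w" for w
    by (simp add: foldl_eq_frac_value F_def)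
  moreover have "inj_on (foldl (\<lambda>n d. n * b + d) p) (one_occurrence_tails n1 n2)"
  proof (rule inj_onI)
    fix w w' assume "w \<in> one_occurrence_tails n1 n2" "w' \<in> one_occurrence_tails n1 n2"
      and eq: "foldl (\<lambda>n d. n * b + d) p w = foldl (\<lambda>n d. n * b + d) p w'"
    then have "n1 # n2 # w = n1 # n2 # w'"
      using assms base_digits_foldl_prefix[of n1 n2] unfolding p_def one_occurrence_tails_def
      by (metis mem_Collect_eq)
    then show "w = w'" by simp
  qed
  ultimately show ?thesis
    unfolding p_def[symmetric] by (subst has_sum_reindex) (auto simp: o_def)
qed

text \<open>
  Every number with an occurrence has at least two digits, so the first two digits split the set. The
  prefix \<open>\<alpha>\<beta>\<close> is present only for \<open>\<alpha> \<noteq> 0\<close>, as leading digits are nonzero. The grouping separates the sums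
  governed by the moments of class 1 from those governed by the moments of class 0.
\<close>

lemma has_sum_one_occurrence_set:
  "((\<lambda>n. 1 / real n) has_sum
     ((\<Sum>(n1, n2)\<in>{1..<b} \<times> {0..<b} - {(\<alpha>, \<beta>)}. tail_sum 1 (n1 * b + n2))
      - (\<Sum>n1\<in>{1..<b}. tail_sum 1 (n1 * b ^ 2 + \<alpha> * b + \<beta>)))
     + (of_bool (\<alpha> \<noteq> 0) * tail_sum 0 (\<alpha> * b + \<beta>)
      + (\<Sum>n1\<in>{1..<b}. tail_sum 0 (n1 * b ^ 2 + \<alpha> * b + \<beta>))))
   (one_occurrence_set b \<alpha> \<beta>)"
proof -
  let ?P = "{1..<b} \<times> {0..<b}"
  let ?h = "\<lambda>(n1, n2). if (n1, n2) = (\<alpha>, \<beta>) then tail_sum 0 (\<alpha> * b + \<beta>) else tail_sum 1 (n1 * b + n2)"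
  let ?B = "\<lambda>(n1, n2). foldl (\<lambda>n d. n * b + d) (n1 * b + n2) ` one_occurrence_tails n1 n2"
  have total: "((\<lambda>n. 1 / real n) has_sum (\<Sum>q\<in>?P. ?h q - of_bool (snd q = \<alpha>) * correction (fst q))) (\<Union>q\<in>?P. ?B q)"
  proof (rule sum_has_sum)
    fix q assume "q \<in> ?P"
    then show "((\<lambda>n. 1 / real n) has_sum (?h q - of_bool (snd q = \<alpha>) * correction (fst q))) (?B q)"
      using has_sum_one_occurrence_prefix[of "fst q" "snd q"] by (cases q) auto
  next
    fix q q' assume q: "q \<in> ?P" "q' \<in> ?P" "q \<noteq> q'"
    have digits: "\<exists>w. base_digits b n = fst q # snd q # w" if "q \<in> ?P" "n \<in> ?B q" for q n
      using that base_digits_foldl_prefix[of "fst q" "snd q"]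
      by (cases q) (auto simp: one_occurrence_tails_def)
    show "?B q \<inter> ?B q' = {}"
    proof (rule ccontr)
      assume "?B q \<inter> ?B q' \<noteq> {}"
      then obtain n where "n \<in> ?B q" "n \<in> ?B q'" by blast
      then have "fst q = fst q' \<and> snd q = snd q'"
        using digits[of q n] digits[of q' n] q by auto
      with q(3) show False by (simp add: prod_eq_iff)
    qed
  qed simp
  have cover: "(\<Union>q\<in>?P. ?B q) = one_occurrence_set b \<alpha> \<beta>"
    by (rule one_occurrence_set_eq_Union[symmetric])
  have heads: "(\<Sum>q\<in>?P. ?h q) = (\<Sum>(n1, n2)\<in>?P - {(\<alpha>, \<beta>)}. tail_sum 1 (n1 * b + n2))
      + of_bool (\<alpha> \<noteq> 0) * tail_sum 0 (\<alpha> * b + \<beta>)"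
  proof -
    have rest: "(\<Sum>q\<in>?P - {(\<alpha>, \<beta>)}. ?h q) = (\<Sum>(n1, n2)\<in>?P - {(\<alpha>, \<beta>)}. tail_sum 1 (n1 * b + n2))"
      by (intro sum.cong) (auto split: if_splits)
    show ?thesis
    proof (cases "\<alpha> = 0")
      case True
      then have "?P - {(\<alpha>, \<beta>)} = ?P" by auto
      with rest True show ?thesis by simp
    next
      case False
      then have "(\<alpha>, \<beta>) \<in> ?P" using \<alpha>_less \<beta>_less by auto
      then have "(\<Sum>q\<in>?P. ?h q) = ?h (\<alpha>, \<beta>) + (\<Sum>q\<in>?P - {(\<alpha>, \<beta>)}. ?h q)"
        by (intro sum.remove) auto
      with rest False show ?thesis by simp
    qed
  qed
  have corrections: "(\<Sum>q\<in>?P. of_bool (snd q = \<alpha>) * correction (fst q)) = (\<Sum>n1\<in>{1..<b}. correction n1)"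
  proof -
    have "(\<Sum>n2\<in>{0..<b}. of_bool (n2 = \<alpha>) * correction n1) = correction n1" for n1
    proof -
      have "(\<Sum>n2\<in>{0..<b}. of_bool (n2 = \<alpha>) * correction n1)
          = (\<Sum>n2\<in>{0..<b}. if n2 = \<alpha> then correction n1 else 0)"
        by (intro sum.cong) auto
      then show ?thesis using \<alpha>_less by simp
    qed
    then show ?thesis
      by (simp add: sum.cartesian_product' case_prod_beta flip: sum.cartesian_product)
  qed
  have regroup: "a + c - (d - e) = (a - d) + (c + e)" for a c d e :: real
    by simp
  show ?thesis
    using total unfolding cover sum_subtractf heads corrections
    unfolding correction_def sum_subtractf regroup .
qed

section \<open>Expansion into the moment series\<close>

lemma v_factor_sums:
  "(\<lambda>m. (-1) ^ m * moment 1 m * v_factor b \<alpha> \<beta> m) sums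
     ((\<Sum>(n1, n2)\<in>{1..<b} \<times> {0..<b} - {(\<alpha>, \<beta>)}. tail_sum 1 (n1 * b + n2))
      - (\<Sum>n1\<in>{1..<b}. tail_sum 1 (n1 * b ^ 2 + \<alpha> * b + \<beta>)))"
proof -
  have "(\<lambda>m. (\<Sum>q\<in>{1..<b} \<times> {0..<b} - {(\<alpha>, \<beta>)}.
        (-1) ^ m * moment 1 m * (1 / real (fst q * b + snd q) ^ (m + 1)))
      - (\<Sum>n1\<in>{1..<b}. (-1) ^ m * moment 1 m * (1 / real (n1 * b ^ 2 + \<alpha> * b + \<beta>) ^ (m + 1)))) sums
     ((\<Sum>q\<in>{1..<b} \<times> {0..<b} - {(\<alpha>, \<beta>)}. tail_sum 1 (fst q * b + snd q))
      - (\<Sum>n1\<in>{1..<b}. tail_sum 1 (n1 * b ^ 2 + \<alpha> * b + \<beta>)))"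
    by (intro sums_diff sums_sum tail_sum_sums two_digit_ge_2 three_digit_ge_2) auto
  then show ?thesis
    by (simp add: v_factor_def case_prod_beta right_diff_distrib sum_distrib_left)
qed

lemma u_factor_sums:
  "(\<lambda>m. (-1) ^ m * moment 0 m * u_factor b \<alpha> \<beta> m) sums
     (of_bool (\<alpha> \<noteq> 0) * tail_sum 0 (\<alpha> * b + \<beta>)
      + (\<Sum>n1\<in>{1..<b}. tail_sum 0 (n1 * b ^ 2 + \<alpha> * b + \<beta>)))"
proof -
  have "(\<lambda>m. of_bool (\<alpha> \<noteq> 0) * ((-1) ^ m * moment 0 m * (1 / real (\<alpha> * b + \<beta>) ^ (m + 1)))) sums
      (of_bool (\<alpha> \<noteq> 0) * tail_sum 0 (\<alpha> * b + \<beta>))"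
  proof (cases "\<alpha> = 0")
    case False
    then have "\<alpha> * b + \<beta> \<ge> 2" using \<alpha>_less by (intro two_digit_ge_2) simp
    then show ?thesis by (intro sums_mult tail_sum_sums)
  qed simp
  then have "(\<lambda>m. of_bool (\<alpha> \<noteq> 0) * ((-1) ^ m * moment 0 m * (1 / real (\<alpha> * b + \<beta>) ^ (m + 1)))
      + (\<Sum>n1\<in>{1..<b}. (-1) ^ m * moment 0 m * (1 / real (n1 * b ^ 2 + \<alpha> * b + \<beta>) ^ (m + 1)))) sums
     (of_bool (\<alpha> \<noteq> 0) * tail_sum 0 (\<alpha> * b + \<beta>)
      + (\<Sum>n1\<in>{1..<b}. tail_sum 0 (n1 * b ^ 2 + \<alpha> * b + \<beta>)))"
    by (intro sums_add sums_sum tail_sum_sums three_digit_ge_2)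
  then show ?thesis
    by (simp add: u_factor_def distrib_left sum_distrib_left mult.commute mult.left_commute)
qed

text \<open>
  For \<open>m = 0\<close> both factors are multiplied by the same mass \<open>b\<^sup>2\<close>, so they may be added: the three-digit
  corrections cancel, and \<open>\<alpha>\<beta>\<close> fills the gap among the two-digit numbers.
\<close>

lemma factors_zero:
  "v_factor b \<alpha> \<beta> 0 + u_factor b \<alpha> \<beta> 0 = (\<Sum>n\<in>{b..<b ^ 2}. 1 / real n)"
proof -
  let ?P = "{1..<b} \<times> {0..<b}"
  let ?f = "\<lambda>(n1, n2). 1 / real (n1 * b + n2)"
  have "(\<Sum>q\<in>?P. ?f q) = (\<Sum>q\<in>?P - {(\<alpha>, \<beta>)}. ?f q) + of_bool (\<alpha> \<noteq> 0) / real (\<alpha> * b + \<beta>)"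
  proof (cases "\<alpha> = 0")
    case True
    then have "?P - {(\<alpha>, \<beta>)} = ?P" by auto
    with True show ?thesis by simp
  next
    case False
    then have "(\<alpha>, \<beta>) \<in> ?P" using \<alpha>_less \<beta>_less by auto
    then have "(\<Sum>q\<in>?P. ?f q) = ?f (\<alpha>, \<beta>) + (\<Sum>q\<in>?P - {(\<alpha>, \<beta>)}. ?f q)"
      by (intro sum.remove) auto
    with False show ?thesis by simp
  qed
  moreover have "(\<Sum>q\<in>?P. ?f q) = (\<Sum>n\<in>{b..<b ^ 2}. 1 / real n)"
  proof (rule sum.reindex_bij_witness[where i = "\<lambda>n. (n div b, n mod b)"
        and j = "\<lambda>(n1, n2). n1 * b + n2"], goal_cases)
    case (2 q)
    obtain n1 n2 where q: "q = (n1, n2)" by (cases q)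
    with 2 have "1 \<le> n1" "Suc n1 \<le> b" "n2 < b" by auto
    then have "b \<le> n1 * b + n2" "n1 * b + n2 < b * b"
      using mult_le_mono1[of 1 n1 b] mult_le_mono1[of "Suc n1" b b] unfolding mult_Suc mult_1 by linarith+
    with q show ?case by (simp add: power2_eq_square)
  next
    case (4 n)
    then have "n div b \<ge> 1" "n div b < b"
      using base by (auto simp: less_mult_imp_div_less power2_eq_square Suc_le_eq div_greater_zero_iff)
    then show ?case using base by auto
  qed (use base in auto)
  ultimately show ?thesis
    by (simp add: v_factor_def u_factor_def)
qed

end

theorem theorem15:
  fixes b \<alpha> \<beta> :: nat and u v :: "nat \<Rightarrow> real"
  assumes "b > 1" and "\<alpha> < b" and "\<beta> < b" and "\<alpha> \<noteq> \<beta>"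
    and "u 0 = real b ^ 2" and "v 0 = real b ^ 2"
    and "\<And>m. m \<ge> 1 \<Longrightarrow>
      (real b ^ (m + 1) - real b + real b powi (- int m - 1)) * u m =
        (\<Sum>j=1..m. real (m choose j) *
          (digit_power_sum b j - real b powi (- int m - 1) * real (\<alpha> * b + \<beta>) ^ j) * u (m - j))"
    and "\<And>m. m \<ge> 1 \<Longrightarrow>
      (real b ^ (m + 1) - real b + real b powi (- int m - 1)) * v m =
        (\<Sum>j=1..m. real (m choose j) *
          ((digit_power_sum b j - real b powi (- int m - 1) * real (\<alpha> * b + \<beta>) ^ j) * v (m - j)
           + real b powi (- int m - 1) * real (\<alpha> * b + \<beta>) ^ j * u (m - j)))
        + real b powi (- int m - 1) * u m"
  shows "(\<lambda>n. 1 / real n) summable_on one_occurrence_set b \<alpha> \<beta> \<and>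
    summable (\<lambda>k. (-1) ^ Suc k * v (Suc k) * v_factor b \<alpha> \<beta> (Suc k)) \<and>
    summable (\<lambda>k. (-1) ^ Suc k * u (Suc k) * u_factor b \<alpha> \<beta> (Suc k)) \<and>
    (\<Sum>\<^sub>\<infinity>n\<in>one_occurrence_set b \<alpha> \<beta>. 1 / real n) =
      real b ^ 2 * (\<Sum>n\<in>{b..<b ^ 2}. 1 / real n)
      + (\<Sum>k. (-1) ^ Suc k * v (Suc k) * v_factor b \<alpha> \<beta> (Suc k))
      + (\<Sum>k. (-1) ^ Suc k * u (Suc k) * u_factor b \<alpha> \<beta> (Suc k))"
proof -
  interpret digit_pair b \<alpha> \<beta>
    using assms(1-4) by unfold_locales
  \<comment> \<open>For \<open>k = 0\<close> the inhomogeneous sequence \<open>t\<close> consists of the moments of the empty class \<open>-1\<close>.\<close>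
  have u: "u = moment 0"
  proof (rule moment_unique[where t = "\<lambda>_. 0"], goal_cases)
    case (3 m)
    show ?case using assms(7)[OF 3] by (simp add: mult.assoc)
  qed (use assms(5) moment_zero[of 0] in \<open>auto simp: moment_neg\<close>)
  have v: "v = moment 1"
  proof (rule moment_unique[where t = u], goal_cases)
    case (3 m)
    show ?case by (rule assms(8)[OF 3])
  qed (use assms(6) moment_zero[of 0] moment_zero[of 1] in \<open>auto simp: moment_neg u\<close>)
  note V = v_factor_sums[folded v]
  note U = u_factor_sums[folded u]
  have "(\<Sum>\<^sub>\<infinity>n\<in>one_occurrence_set b \<alpha> \<beta>. 1 / real n) =
      (\<Sum>m. (-1) ^ m * v m * v_factor b \<alpha> \<beta> m) + (\<Sum>m. (-1) ^ m * u m * u_factor b \<alpha> \<beta> m)"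
    using infsumI[OF has_sum_one_occurrence_set] sums_unique[OF V] sums_unique[OF U] by simp
  also have "(\<Sum>m. (-1) ^ m * v m * v_factor b \<alpha> \<beta> m) =
      v 0 * v_factor b \<alpha> \<beta> 0 + (\<Sum>k. (-1) ^ Suc k * v (Suc k) * v_factor b \<alpha> \<beta> (Suc k))"
    using suminf_split_head[OF sums_summable[OF V]] by simp
  also have "(\<Sum>m. (-1) ^ m * u m * u_factor b \<alpha> \<beta> m) =
      u 0 * u_factor b \<alpha> \<beta> 0 + (\<Sum>k. (-1) ^ Suc k * u (Suc k) * u_factor b \<alpha> \<beta> (Suc k))"
    using suminf_split_head[OF sums_summable[OF U]] by simp
  finally have total: "(\<Sum>\<^sub>\<infinity>n\<in>one_occurrence_set b \<alpha> \<beta>. 1 / real n) =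
      real b ^ 2 * (\<Sum>n\<in>{b..<b ^ 2}. 1 / real n)
      + (\<Sum>k. (-1) ^ Suc k * v (Suc k) * v_factor b \<alpha> \<beta> (Suc k))
      + (\<Sum>k. (-1) ^ Suc k * u (Suc k) * u_factor b \<alpha> \<beta> (Suc k))"
    unfolding factors_zero[symmetric] using assms(5,6) by (simp add: distrib_left)
  show ?thesis
    using has_sum_one_occurrence_set total
      summable_Suc_iff[THEN iffD2, OF sums_summable[OF V]]
      summable_Suc_iff[THEN iffD2, OF sums_summable[OF U]]
    by (auto simp: summable_on_def)
qed

end
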